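(* Let $G$ be a Peano partial cube. Then every finite convex regular subgraph of $G$ is gated.
   Context: Graphs are simple, undirected, possibly infinite. In a connected graph $G$, $I_G(x,y)$ is the set of vertices on shortest $(x,y)$-paths; $A\subseteq V(G)$ is convex if $I_G(x,y)\subseteq A$ for all $x,y\in A$; a subgraph is convex if its vertex set is; $co_G$ is the convex hull and $\mathcal{I}_G(A)=\bigcup_{x,y\in A}I_G(x,y)$. A partial cube is an isometric subgraph of a (possibly infinite) hypercube. A copoint at $x$ is a convex set maximal with respect to not containing $x$; $ph(G)$ is the least $n$ with $co_G(C\cup\{x\})=\mathcal{I}^n_G(C\cup\{x\})$ for all $x$ and copoints $C$ at $x$. A Peano partial cube is a partial cube all of whose finite convex subgraphs have pre-hull number at most $1$. A subgraph $H$ is gated if for each vertex $x$ of $G$ there is $y\in V(H)$ with $y\in I_G(x,z)$ for all $z\in V(H)$. Regular means all vertices have the same degree. *)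

theory Defs
  imports Main "HOL-Library.Extended_Nat"
begin

definition graph :: "'a set \<Rightarrow> ('a \<Rightarrow> 'a \<Rightarrow> bool) \<Rightarrow> bool" where
  "graph V E \<longleftrightarrow> (\<forall>x y. E x y \<longrightarrow> x \<in> V \<and> y \<in> V \<and> E y x \<and> x \<noteq> y)"

definition walk :: "'a set \<Rightarrow> ('a \<Rightarrow> 'a \<Rightarrow> bool) \<Rightarrow> 'a list \<Rightarrow> bool" where
  "walk V E xs \<longleftrightarrow> xs \<noteq> [] \<and> set xs \<subseteq> V \<and>
     (\<forall>i. Suc i < length xs \<longrightarrow> E (xs ! i) (xs ! Suc i))"

definition connected_graph :: "'a set \<Rightarrow> ('a \<Rightarrow> 'a \<Rightarrow> bool) \<Rightarrow> bool" where
  "connected_graph V E \<longleftrightarrow>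
     (\<forall>x\<in>V. \<forall>y\<in>V. \<exists>xs. walk V E xs \<and> hd xs = x \<and> last xs = y)"

text \<open>Graph distance (meaningful in connected graphs).\<close>
definition gdist :: "'a set \<Rightarrow> ('a \<Rightarrow> 'a \<Rightarrow> bool) \<Rightarrow> 'a \<Rightarrow> 'a \<Rightarrow> nat" where
  "gdist V E x y = (LEAST n. \<exists>xs. walk V E xs \<and> hd xs = x \<and> last xs = y \<and> length xs = Suc n)"

definition interval :: "'a set \<Rightarrow> ('a \<Rightarrow> 'a \<Rightarrow> bool) \<Rightarrow> 'a \<Rightarrow> 'a \<Rightarrow> 'a set" where
  "interval V E x y = {z. \<exists>xs. walk V E xs \<and> hd xs = x \<and> last xs = y \<and>
       length xs = Suc (gdist V E x y) \<and> z \<in> set xs}"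

definition convex :: "'a set \<Rightarrow> ('a \<Rightarrow> 'a \<Rightarrow> bool) \<Rightarrow> 'a set \<Rightarrow> bool" where
  "convex V E A \<longleftrightarrow> A \<subseteq> V \<and> (\<forall>x\<in>A. \<forall>y\<in>A. interval V E x y \<subseteq> A)"

definition convex_hull_g :: "'a set \<Rightarrow> ('a \<Rightarrow> 'a \<Rightarrow> bool) \<Rightarrow> 'a set \<Rightarrow> 'a set" where
  "convex_hull_g V E A = \<Inter>{C. convex V E C \<and> A \<subseteq> C}"

definition Iset :: "'a set \<Rightarrow> ('a \<Rightarrow> 'a \<Rightarrow> bool) \<Rightarrow> 'a set \<Rightarrow> 'a set" where
  "Iset V E A = (\<Union>x\<in>A. \<Union>y\<in>A. interval V E x y)"

definition copoint :: "'a set \<Rightarrow> ('a \<Rightarrow> 'a \<Rightarrow> bool) \<Rightarrow> 'a \<Rightarrow> 'a set \<Rightarrow> bool" where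
  "copoint V E x C \<longleftrightarrow> x \<in> V \<and> convex V E C \<and> x \<notin> C \<and>
     (\<forall>D. convex V E D \<and> C \<subseteq> D \<and> x \<notin> D \<longrightarrow> D = C)"

definition ph_prop :: "'a set \<Rightarrow> ('a \<Rightarrow> 'a \<Rightarrow> bool) \<Rightarrow> nat \<Rightarrow> bool" where
  "ph_prop V E n \<longleftrightarrow> (\<forall>x C. copoint V E x C \<longrightarrow>
     convex_hull_g V E (insert x C) = (Iset V E ^^ n) (insert x C))"

definition pre_hull_number :: "'a set \<Rightarrow> ('a \<Rightarrow> 'a \<Rightarrow> bool) \<Rightarrow> enat" where
  "pre_hull_number V E = (if \<exists>n. ph_prop V E n then enat (LEAST n. ph_prop V E n) else \<infinity>)"

definition induced :: "('a \<Rightarrow> 'a \<Rightarrow> bool) \<Rightarrow> 'a set \<Rightarrow> 'a \<Rightarrow> 'a \<Rightarrow> bool" where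
  "induced E A x y \<longleftrightarrow> E x y \<and> x \<in> A \<and> y \<in> A"

text \<open>G is an isometric subgraph of the hypercube on the finite subsets of the
  index set UNIV :: 'i set, via the embedding f.\<close>
definition partial_cube_emb :: "'a set \<Rightarrow> ('a \<Rightarrow> 'a \<Rightarrow> bool) \<Rightarrow> ('a \<Rightarrow> 'i set) \<Rightarrow> bool" where
  "partial_cube_emb V E f \<longleftrightarrow> graph V E \<and> connected_graph V E \<and>
     (\<forall>x\<in>V. finite (f x)) \<and>
     (\<forall>x\<in>V. \<forall>y\<in>V. gdist V E x y = card ((f x - f y) \<union> (f y - f x)))"

definition peano :: "'a set \<Rightarrow> ('a \<Rightarrow> 'a \<Rightarrow> bool) \<Rightarrow> bool" where
  "peano V E \<longleftrightarrow> (\<forall>A. finite A \<and> convex V E A \<longrightarrow> pre_hull_number A (induced E A) \<le> 1)"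

definition regular :: "'a set \<Rightarrow> ('a \<Rightarrow> 'a \<Rightarrow> bool) \<Rightarrow> bool" where
  "regular V E \<longleftrightarrow> (\<exists>k. \<forall>x\<in>V. card {y \<in> V. E x y} = k)"

definition gated :: "'a set \<Rightarrow> ('a \<Rightarrow> 'a \<Rightarrow> bool) \<Rightarrow> 'a set \<Rightarrow> bool" where
  "gated V E A \<longleftrightarrow> (\<forall>x\<in>V. \<exists>y\<in>A. \<forall>z\<in>A. y \<in> interval V E x z)"

end

theory Submission
  imports Defs
begin

text \<open>
  Vertices are identified with their finite coordinate sets, so that betweenness can be read off
  coordinate by coordinate. Pre-hull number at most one, applied to the copoint formed by one side
  of a coordinate, says: if \<open>x\<close> and \<open>v\<close> lie in the hull of the boundary of the same side, then
  \<open>v\<close> is between \<open>x\<close> and some boundary vertex of that side.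

  In a finite regular convex set take \<open>r\<close> at maximal distance from some vertex; all edges at \<open>r\<close>
  point towards that vertex. Let \<open>y\<close> be nearest to \<open>r\<close> among the vertices lying across all edges
  at \<open>r\<close>. The stability property shows that the interval from \<open>r\<close> to \<open>y\<close> has the same edge
  directions at \<open>r\<close> and at \<open>y\<close>, that this persists when both ends move along a common direction
  (so the interval is antipodal), and that degrees inside the interval do not drop along edges.
  By regularity the interval is closed under taking neighbours, hence is the whole set.

  An antipodal convex set is gated: walking towards it, if the gate \<open>y\<close> of the previous vertex were
  lost when crossing direction \<open>e\<close>, then the antipode of \<open>y\<close> would contradict stability for \<open>e\<close>
  in the hull of the set and the new vertex.
\<close>

section \<open>Isometric families of finite sets\<close>

definition toggle :: "'i \<Rightarrow> 'i set \<Rightarrow> 'i set" where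
  "toggle i x = (if i \<in> x then x - {i} else insert i x)"

lemma mem_toggle [simp]: "j \<in> toggle i x \<longleftrightarrow> (if j = i then i \<notin> x else j \<in> x)"
  by (auto simp: toggle_def)

lemma toggle_toggle [simp]: "toggle i (toggle i x) = x"
  by (auto simp: set_eq_iff)

lemma toggle_eq_iff [simp]: "toggle i x = toggle j x \<longleftrightarrow> i = j"
  by (metis mem_toggle)

lemma finite_toggle [simp]: "finite (toggle i x) \<longleftrightarrow> finite x"
  by (simp add: toggle_def)

text \<open>The third argument is the middle one. This is metric betweenness in the hypercube, see
  \<open>btw_iff_hdist\<close>.\<close>

definition btw :: "'i set \<Rightarrow> 'i set \<Rightarrow> 'i set \<Rightarrow> bool" where
  "btw x y z \<longleftrightarrow> (\<forall>i. (i \<in> x \<longleftrightarrow> i \<in> y) \<longrightarrow> (i \<in> z \<longleftrightarrow> i \<in> x))"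

lemma btwD: "btw x y z \<Longrightarrow> (i \<in> x) = (i \<in> y) \<Longrightarrow> (i \<in> z) = (i \<in> x)"
  by (simp add: btw_def)

lemma btw_commute: "btw x y z \<longleftrightarrow> btw y x z"
  by (auto simp: btw_def)

definition hdist :: "'i set \<Rightarrow> 'i set \<Rightarrow> nat" where
  "hdist x y = card ((x - y) \<union> (y - x))"

lemma hdist_commute: "hdist x y = hdist y x"
  by (simp add: hdist_def Un_commute)

lemma hdist_eq_0: "finite x \<Longrightarrow> finite y \<Longrightarrow> hdist x y = 0 \<longleftrightarrow> x = y"
  by (auto simp: hdist_def)

lemma hdist_toggle:
  assumes "finite x" "finite y" "(i \<in> x) \<noteq> (i \<in> y)"
  shows "hdist x y = Suc (hdist (toggle i x) y)"
proof -
  have "(x - y) \<union> (y - x) = insert i ((toggle i x - y) \<union> (y - toggle i x))"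
    "i \<notin> (toggle i x - y) \<union> (y - toggle i x)"
    using assms(3) by (auto split: if_splits)
  then show ?thesis
    using assms by (simp add: hdist_def)
qed

lemma hdist_toggle':
  assumes "finite x" "finite y" "(i \<in> x) \<noteq> (i \<in> y)"
  shows "hdist x y = Suc (hdist x (toggle i y))"
  using hdist_toggle[of y x i] assms by (metis hdist_commute)

text \<open>Isometricity in local form: iterating the step yields a geodesic of the hypercube inside
  \<open>F\<close>, without any mention of paths.\<close>

definition iso_family :: "'i set set \<Rightarrow> bool" where
  "iso_family F \<longleftrightarrow> (\<forall>x\<in>F. finite x) \<and>
     (\<forall>x\<in>F. \<forall>y\<in>F. x \<noteq> y \<longrightarrow> (\<exists>i. (i \<in> x) \<noteq> (i \<in> y) \<and> toggle i x \<in> F))"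

lemma iso_family_finite: "iso_family F \<Longrightarrow> x \<in> F \<Longrightarrow> finite x"
  unfolding iso_family_def by (drule conjunct1) (rule bspec)

lemma iso_family_step:
  assumes "iso_family F" "x \<in> F" "y \<in> F" "x \<noteq> y"
  obtains i where "(i \<in> x) \<noteq> (i \<in> y)" "toggle i x \<in> F"
  using assms(1)[unfolded iso_family_def, THEN conjunct2, THEN bspec, OF assms(2), THEN bspec, OF assms(3)]
    assms(4) that by iprover

section \<open>Convexity and separation by coordinates\<close>

definition convex_family :: "'i set set \<Rightarrow> 'i set set \<Rightarrow> bool" where
  "convex_family F C \<longleftrightarrow> C \<subseteq> F \<and> (\<forall>x\<in>C. \<forall>y\<in>C. \<forall>z\<in>F. btw x y z \<longrightarrow> z \<in> C)"

lemma convex_familyD: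
  assumes "convex_family F C" "x \<in> C" "y \<in> C" "z \<in> F" "btw x y z"
  shows "z \<in> C"
  using assms(1)[unfolded convex_family_def, THEN conjunct2, THEN bspec, OF assms(2),
      THEN bspec, OF assms(3), THEN bspec, OF assms(4)] assms(5) by (rule mp)

lemma convex_family_subset: "convex_family F C \<Longrightarrow> C \<subseteq> F"
  unfolding convex_family_def by (rule conjunct1)

lemma convex_familyI:
  assumes "C \<subseteq> F" "\<And>x y z. x \<in> C \<Longrightarrow> y \<in> C \<Longrightarrow> z \<in> F \<Longrightarrow> btw x y z \<Longrightarrow> z \<in> C"
  shows "convex_family F C"
  unfolding convex_family_def using assms by (intro conjI ballI impI)

lemma convex_family_refl: "convex_family F F"
  by (rule convex_familyI) simp_all

lemma convex_family_trans:
  assumes "convex_family F C" "convex_family C D"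
  shows "convex_family F D"
proof (rule convex_familyI)
  show "D \<subseteq> F" using assms convex_family_subset by blast
next
  fix x y z assume *: "x \<in> D" "y \<in> D" "z \<in> F" "btw x y z"
  then have "x \<in> C" "y \<in> C" using convex_family_subset[OF assms(2)] by auto
  then have "z \<in> C" using convex_familyD[OF assms(1) _ _ *(3,4)] by blast
  then show "z \<in> D" using convex_familyD[OF assms(2) *(1,2) _ *(4)] by blast
qed

lemma iso_family_convex:
  assumes "iso_family F" "convex_family F C"
  shows "iso_family C"
  unfolding iso_family_def
proof (intro conjI ballI impI)
  fix x assume "x \<in> C"
  then show "finite x"
    using assms iso_family_finite convex_family_subset by blast
next
  fix x y assume *: "x \<in> C" "y \<in> C" "x \<noteq> y"
  then obtain i where "(i \<in> x) \<noteq> (i \<in> y)" "toggle i x \<in> F"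
    using iso_family_step[OF assms(1)] convex_family_subset[OF assms(2)] by (metis subset_iff)
  moreover have "toggle i x \<in> C"
    using * convex_familyD[OF assms(2) *(1,2)] calculation by (auto simp: btw_def)
  ultimately show "\<exists>i. (i \<in> x) \<noteq> (i \<in> y) \<and> toggle i x \<in> C" by blast
qed

text \<open>Walk from \<open>v\<close> towards \<open>w\<close> one coordinate at a time;
  \<open>u\<close> is the vertex at which \<open>e\<close> is about to be flipped.\<close>

lemma crossing_edge:
  assumes "iso_family F" "v \<in> F" "w \<in> F" "(e \<in> v) \<noteq> (e \<in> w)"
  obtains u where "u \<in> F" "toggle e u \<in> F" "(e \<in> u) = (e \<in> v)" "btw v w u"
proof -
  have "\<exists>u. u \<in> F \<and> toggle e u \<in> F \<and> (e \<in> u) = (e \<in> v) \<and> btw v w u"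
    using assms(2-)
  proof (induction "hdist v w" arbitrary: v rule: less_induct)
    case less
    obtain i where i: "(i \<in> v) \<noteq> (i \<in> w)" "toggle i v \<in> F"
      using iso_family_step[OF assms(1) less.prems(1,2)] less.prems(3) by metis
    show ?case
    proof (cases "i = e")
      case True
      then show ?thesis using i less.prems by (auto simp: btw_def)
    next
      case False
      have "hdist (toggle i v) w < hdist v w"
        using hdist_toggle[of v w i] i less.prems iso_family_finite[OF assms(1)] by auto
      from less.hyps[OF this i(2) less.prems(2)] obtain u where
        "u \<in> F" "toggle e u \<in> F" "(e \<in> u) = (e \<in> v)" "btw (toggle i v) w u"
        using False less.prems(3) by auto
      moreover have "btw v w u"
        using calculation(4) i(1) unfolding btw_def by (metis mem_toggle)
      ultimately show ?thesis by blast
    qed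
  qed
  then show ?thesis using that by blast
qed

text \<open>Convex sets are intersections of half-spaces: the first coordinate flipped on a geodesic
  from a nearest member \<open>d\<close> to \<open>z\<close> separates \<open>C\<close> from
  \<open>z\<close>, since otherwise the first step would stay in \<open>C\<close>.\<close>

lemma convex_family_separation:
  assumes "iso_family F" "convex_family F C" "C \<noteq> {}" "z \<in> F"
    and agree: "\<And>i. (\<forall>a\<in>C. \<forall>b\<in>C. (i \<in> a) = (i \<in> b)) \<Longrightarrow> (\<forall>a\<in>C. (i \<in> z) = (i \<in> a))"
  shows "z \<in> C"
proof (rule ccontr)
  assume z: "z \<notin> C"
  obtain d where d: "d \<in> C" "\<And>c. c \<in> C \<Longrightarrow> hdist d z \<le> hdist c z"
    using assms(3) exists_least_iff[of "\<lambda>n. \<exists>c\<in>C. hdist c z = n"]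
    by (metis ex_in_conv leI)
  have dF: "d \<in> F" using d assms convex_family_subset by blast
  have "d \<noteq> z" using d z by auto
  then obtain h where h: "(h \<in> d) \<noteq> (h \<in> z)" "toggle h d \<in> F"
    using iso_family_step[OF assms(1) dF assms(4)] by metis
  have fin: "finite d" "finite z"
    using iso_family_finite[OF assms(1)] dF assms(4) by auto
  have out: "toggle h d \<notin> C"
    using d(2)[of "toggle h d"] hdist_toggle[OF fin h(1)] by auto
  have "(h \<in> a) = (h \<in> d)" if "a \<in> C" for a
  proof (rule ccontr)
    assume "(h \<in> a) \<noteq> (h \<in> d)"
    then have "btw d a (toggle h d)" by (auto simp: btw_def)
    then show False using convex_familyD[OF assms(2) d(1) that h(2)] out by blast
  qed
  then have "\<forall>a\<in>C. (h \<in> z) = (h \<in> a)"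
    by (intro agree) simp
  then show False using d(1) h(1) by blast
qed

section \<open>Intervals and edge directions\<close>

definition seg :: "'i set set \<Rightarrow> 'i set \<Rightarrow> 'i set \<Rightarrow> 'i set set" where
  "seg F x y = {z \<in> F. btw x y z}"

text \<open>An interval is the trace on \<open>F\<close> of a subcube, and subcubes are
  convex.\<close>

lemma convex_seg: "convex_family F (seg F x y)"
proof (rule convex_familyI)
  show "seg F x y \<subseteq> F" unfolding seg_def by (rule Collect_restrict)
next
  fix a b c assume *: "a \<in> seg F x y" "b \<in> seg F x y" "c \<in> F" "btw a b c"
  have "(i \<in> c) = (i \<in> x)" if "(i \<in> x) = (i \<in> y)" for i
  proof -
    have "(i \<in> a) = (i \<in> x)" "(i \<in> b) = (i \<in> x)"
      using *(1,2) that by (simp_all add: seg_def btw_def)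
    then show ?thesis using btwD[OF *(4), of i] by simp
  qed
  then show "c \<in> seg F x y" using *(3) by (simp add: seg_def btw_def)
qed

lemma seg_ends: "x \<in> F \<Longrightarrow> y \<in> F \<Longrightarrow> x \<in> seg F x y \<and> y \<in> seg F x y"
  by (auto simp: seg_def btw_def)

text \<open>Edge directions instead of neighbours, so that different vertices can be
  compared.\<close>

definition nb :: "'i set set \<Rightarrow> 'i set \<Rightarrow> 'i set" where
  "nb F x = {i. toggle i x \<in> F}"

lemma nb_mono: "F \<subseteq> G \<Longrightarrow> nb F x \<subseteq> nb G x"
  by (auto simp: nb_def)

lemma finite_nb: "finite F \<Longrightarrow> finite (nb F x)"
  unfolding nb_def
  by (rule finite_imageD[of "\<lambda>i. toggle i x"]) (auto simp: inj_on_def intro: finite_subset[of _ F])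

section \<open>Peano families and their cells\<close>

text \<open>
  A vertex \<open>u\<close> of \<open>C\<close> is on the boundary of its \<open>e\<close>-side if \<open>toggle e u \<in> C\<close>. The pairs
  \<open>a, b\<close> and \<open>c, d\<close> witness that \<open>x\<close> and \<open>v\<close> lie in the hull of that boundary.
\<close>
definition hull_stable :: "'i set set \<Rightarrow> bool" where
  "hull_stable C \<longleftrightarrow> (\<forall>e x v a b c d.
     {x, v, a, b, c, d} \<subseteq> C \<longrightarrow> {toggle e a, toggle e b, toggle e c, toggle e d} \<subseteq> C \<longrightarrow>
     (e \<in> v) = (e \<in> x) \<longrightarrow> (e \<in> a) = (e \<in> x) \<longrightarrow> (e \<in> b) = (e \<in> x) \<longrightarrow> (e \<in> c) = (e \<in> x) \<longrightarrow> (e \<in> d) = (e \<in> x) \<longrightarrow>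
     btw a b x \<longrightarrow> btw c d v \<longrightarrow>
     (\<exists>u\<in>C. toggle e u \<in> C \<and> (e \<in> u) = (e \<in> x) \<and> btw x u v))"

lemma hull_stableD:
  assumes "hull_stable C" "x \<in> C" "v \<in> C" "(e \<in> v) = (e \<in> x)"
    "a \<in> C" "toggle e a \<in> C" "(e \<in> a) = (e \<in> x)" "b \<in> C" "toggle e b \<in> C" "(e \<in> b) = (e \<in> x)"
    "c \<in> C" "toggle e c \<in> C" "(e \<in> c) = (e \<in> x)" "d \<in> C" "toggle e d \<in> C" "(e \<in> d) = (e \<in> x)"
    "btw a b x" "btw c d v"
  obtains u where "u \<in> C" "toggle e u \<in> C" "(e \<in> u) = (e \<in> x)" "btw x u v"
proof -
  have "\<exists>u\<in>C. toggle e u \<in> C \<and> (e \<in> u) = (e \<in> x) \<and> btw x u v"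
    by (rule assms(1)[unfolded hull_stable_def, rule_format, of x v a b c d e]) (use assms in auto)
  then show ?thesis using that by blast
qed

definition peano_family :: "'i set set \<Rightarrow> bool" where
  "peano_family F \<longleftrightarrow> iso_family F \<and> (\<forall>C. finite C \<longrightarrow> convex_family F C \<longrightarrow> hull_stable C)"

lemma peano_family_convex: "peano_family F \<Longrightarrow> convex_family F C \<Longrightarrow> peano_family C"
  unfolding peano_family_def by (metis iso_family_convex convex_family_trans)

definition spans :: "'i set set \<Rightarrow> 'i set \<Rightarrow> 'i set \<Rightarrow> bool" where
  "spans Z r y \<longleftrightarrow> finite Z \<and> peano_family Z \<and> r \<in> Z \<and> y \<in> Z \<and> (\<forall>z\<in>Z. btw r y z)"

text \<open>In an interval the hull conditions of \<open>hull_stable\<close> hold automatically: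
  \<open>r\<close> is on the boundary of its \<open>i\<close>-side, and every \<open>w\<close> on
  that side lies between \<open>r\<close> and the vertex where a geodesic from \<open>w\<close> to
  \<open>y\<close> crosses \<open>i\<close>.\<close>

lemma spans_stable:
  assumes "spans Z r y" "toggle i r \<in> Z" "x \<in> Z" "v \<in> Z" "(i \<in> x) = (i \<in> r)" "(i \<in> v) = (i \<in> r)"
  obtains u where "u \<in> Z" "toggle i u \<in> Z" "(i \<in> u) = (i \<in> r)" "btw x u v"
proof -
  have iso: "iso_family Z" and Z: "finite Z" "r \<in> Z" "y \<in> Z" "\<And>z. z \<in> Z \<Longrightarrow> btw r y z"
    and hs: "hull_stable Z"
    using assms(1) convex_family_refl by (auto simp: spans_def peano_family_def)
  have y: "(i \<in> y) \<noteq> (i \<in> r)"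
    using Z(4)[OF assms(2)] by (auto simp: btw_def)
  have *: "\<exists>u\<in>Z. toggle i u \<in> Z \<and> (i \<in> u) = (i \<in> r) \<and> btw r u w"
    if w: "w \<in> Z" "(i \<in> w) = (i \<in> r)" for w
  proof -
    obtain u where u: "u \<in> Z" "toggle i u \<in> Z" "(i \<in> u) = (i \<in> w)" "btw w y u"
      using crossing_edge[OF iso w(1) Z(3), of i] y w(2) by metis
    have "btw r u w"
      using u(4) Z(4)[OF w(1)] Z(4)[OF u(1)] unfolding btw_def by blast
    then show ?thesis using u w by auto
  qed
  from *[OF assms(3,5)] obtain b where b: "b \<in> Z" "toggle i b \<in> Z" "(i \<in> b) = (i \<in> r)" "btw r b x" by blast
  from *[OF assms(4,6)] obtain d where d: "d \<in> Z" "toggle i d \<in> Z" "(i \<in> d) = (i \<in> r)" "btw r d v" by blast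
  show ?thesis
    by (rule hull_stableD[OF hs assms(3,4), of i r b r d]) (use assms Z b d that in auto)
qed

lemma spans_seg:
  assumes "finite F" "peano_family F" "r \<in> F" "y \<in> F"
  shows "spans (seg F r y) r y"
  using assms(1) seg_ends[OF assms(3,4)] peano_family_convex[OF assms(2) convex_seg]
  unfolding spans_def by (simp add: seg_def)

lemma spans_differ:
  assumes "spans Z r y" "a \<in> Z" "b \<in> Z" "(i \<in> a) \<noteq> (i \<in> b)"
  shows "(i \<in> r) \<noteq> (i \<in> y)"
proof -
  have "btw r y a" "btw r y b" using assms by (auto simp: spans_def)
  then show ?thesis using assms(4) unfolding btw_def by blast
qed

lemma agree_on_nb:
  assumes "iso_family Z" "x \<in> Z" "y \<in> Z" "\<And>i. i \<in> nb Z y \<Longrightarrow> (i \<in> x) = (i \<in> y)"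
  shows "x = y"
proof (rule ccontr)
  assume "x \<noteq> y"
  then obtain i where "(i \<in> y) \<noteq> (i \<in> x)" "toggle i y \<in> Z"
    using iso_family_step[OF assms(1,3,2)] by metis
  then show False using assms(4)[of i] by (auto simp: nb_def)
qed

text \<open>The directions at \<open>y\<close> also detect the opposite end \<open>r\<close>. This
  upgrades an inclusion of directions to an equality in \<open>cellI\<close>.\<close>

lemma opposite_agree_on_nb:
  assumes sp: "spans Z r y" and sub: "nb Z y \<subseteq> nb Z r"
    and x: "x \<in> Z" "\<And>i. i \<in> nb Z y \<Longrightarrow> (i \<in> x) = (i \<in> r)"
  shows "x = r"
proof (rule ccontr)
  assume "x \<noteq> r"
  then obtain q where q: "(q \<in> x) \<noteq> (q \<in> r)" by auto
  have Z: "finite Z" "iso_family Z" "r \<in> Z" "y \<in> Z" "\<And>z. z \<in> Z \<Longrightarrow> btw r y z"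
    using sp by (auto simp: spans_def peano_family_def)
  have qy: "(q \<in> x) = (q \<in> y)"
    using q Z(5)[OF x(1)] by (auto simp: btw_def)
  have qn: "q \<notin> nb Z y" using x(2) q by blast
  have opp: "(i \<in> r) \<noteq> (i \<in> y)" if "i \<in> nb Z y" for i
    using spans_differ[OF sp Z(4), of "toggle i y" i] that by (auto simp: nb_def)
  \<comment> \<open>Stability with first argument \<open>x\<close> propagates the \<open>q\<close>-side of \<open>y\<close>, which is also that of \<open>x\<close>,
    from \<open>y\<close> to all of \<open>Z\<close>, including \<open>r\<close>.\<close>
  have "(q \<in> v) = (q \<in> y)" if "v \<in> Z" for v
    using that
  proof (induction "card {i \<in> nb Z y. (i \<in> v) = (i \<in> r)}" arbitrary: v rule: less_induct)
    case less
    show ?case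
    proof (cases "\<exists>i\<in>nb Z y. (i \<in> v) = (i \<in> r)")
      case False
      then have "v = y"
        using agree_on_nb[OF Z(2) less.prems Z(4)] opp by blast
      then show ?thesis by simp
    next
      case True
      then obtain i where i: "i \<in> nb Z y" "(i \<in> v) = (i \<in> r)" by blast
      then have "toggle i r \<in> Z" using sub by (auto simp: nb_def)
      then obtain w where w: "w \<in> Z" "toggle i w \<in> Z" "(i \<in> w) = (i \<in> r)" "btw x w v"
        using spans_stable[OF sp _ x(1) less.prems, of i] i x(2) by metis
      \<comment> \<open>\<open>w\<close> agrees with \<open>r\<close> in at most the directions
        where \<open>v\<close> does, because \<open>v\<close> lies between \<open>x\<close> and
        \<open>w\<close> and \<open>x\<close> agrees with \<open>r\<close> on \<open>nb Z y\<close>;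
        toggling \<open>i\<close> loses one more.\<close>
      have "{l \<in> nb Z y. (l \<in> toggle i w) = (l \<in> r)} \<subset> {l \<in> nb Z y. (l \<in> v) = (l \<in> r)}"
      proof
        show "{l \<in> nb Z y. (l \<in> toggle i w) = (l \<in> r)} \<subseteq> {l \<in> nb Z y. (l \<in> v) = (l \<in> r)}"
          using w(3,4) x(2) unfolding btw_def by (auto split: if_splits)
        have "i \<in> {l \<in> nb Z y. (l \<in> v) = (l \<in> r)}" "i \<notin> {l \<in> nb Z y. (l \<in> toggle i w) = (l \<in> r)}"
          using i w(3) by auto
        then show "{l \<in> nb Z y. (l \<in> toggle i w) = (l \<in> r)} \<noteq> {l \<in> nb Z y. (l \<in> v) = (l \<in> r)}" by blast
      qed
      then have "card {l \<in> nb Z y. (l \<in> toggle i w) = (l \<in> r)} < card {l \<in> nb Z y. (l \<in> v) = (l \<in> r)}"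
        using finite_nb[OF Z(1)] by (intro psubset_card_mono) auto
      from less.hyps[OF this w(2)] have "(q \<in> w) = (q \<in> y)"
        using qn i(1) by (auto split: if_splits)
      then show ?thesis using w(4) qy unfolding btw_def by blast
    qed
  qed
  then show False using Z(3) q qy by blast
qed

definition cell :: "'i set set \<Rightarrow> 'i set \<Rightarrow> 'i set \<Rightarrow> bool" where
  "cell Z r y \<longleftrightarrow> spans Z r y \<and> nb Z r = nb Z y"

text \<open>A direction \<open>i\<close> at \<open>r\<close> missing at \<open>y\<close> would make
  \<open>toggle i r\<close> agree with \<open>r\<close> on \<open>nb Z y\<close>, forcing
  \<open>toggle i r = r\<close>.\<close>

lemma cellI:
  assumes sp: "spans Z r y" and sub: "nb Z y \<subseteq> nb Z r"
  shows "cell Z r y"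
proof -
  have "i \<in> nb Z y" if "i \<in> nb Z r" for i
  proof (rule ccontr)
    assume "i \<notin> nb Z y"
    then have "(j \<in> toggle i r) = (j \<in> r)" if "j \<in> nb Z y" for j
      using that by auto
    moreover have "toggle i r \<in> Z" using that by (simp add: nb_def)
    ultimately have "toggle i r = r"
      using opposite_agree_on_nb[OF sp sub] by blast
    then show False using mem_toggle[of i i r] by auto
  qed
  then show ?thesis using assms by (auto simp: cell_def)
qed

text \<open>Choose \<open>y\<close> nearest to \<open>r\<close> among the vertices across all
  directions of \<open>D\<close>; \<open>y0\<close> shows that there is one. By minimality the edges
  at \<open>y\<close> that lead back towards \<open>r\<close> have directions in \<open>D\<close>,
  so \<open>cellI\<close> applies.\<close>

lemma subcell:
  assumes "finite F" "peano_family F" "r \<in> F" "D \<subseteq> nb F r"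
    and "y0 \<in> F" "\<And>i. i \<in> D \<Longrightarrow> (i \<in> y0) \<noteq> (i \<in> r)"
  obtains y where "y \<in> F" "cell (seg F r y) r y" "nb (seg F r y) r = D"
    "\<forall>i\<in>D. (i \<in> y) \<noteq> (i \<in> r)"
proof -
  let ?P = "\<lambda>y. y \<in> F \<and> (\<forall>i\<in>D. (i \<in> y) \<noteq> (i \<in> r))"
  define y where "y = arg_min (hdist r) ?P"
  have y: "?P y" "\<And>z. ?P z \<Longrightarrow> hdist r y \<le> hdist r z"
    using arg_min_natI[of ?P y0 "hdist r"] arg_min_nat_le[of ?P _ "hdist r"] assms(5,6)
    by (auto simp: y_def)
  have sp: "spans (seg F r y) r y"
    using spans_seg[OF assms(1-3)] y by blast
  have fin: "finite r" "finite y"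
    using assms y by (auto simp: peano_family_def iso_family_finite)
  have 1: "nb (seg F r y) y \<subseteq> D"
  proof
    fix i assume "i \<in> nb (seg F r y) y"
    then have i: "toggle i y \<in> F" "(i \<in> r) \<noteq> (i \<in> y)"
      by (auto simp: nb_def seg_def btw_def)
    show "i \<in> D"
    proof (rule ccontr)
      assume "i \<notin> D"
      then have "?P (toggle i y)" using y i by auto
      then have "hdist r y \<le> hdist r (toggle i y)" using y(2) by blast
      then show False using hdist_toggle'[OF fin i(2)] by simp
    qed
  qed
  have 2: "D \<subseteq> nb (seg F r y) r"
    using assms(4) y(1) by (auto simp: nb_def seg_def btw_def)
  from cellI[OF sp] 1 2 have c: "cell (seg F r y) r y" by blast
  then have "nb (seg F r y) r = D" using 1 2 by (auto simp: cell_def)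
  then show ?thesis using that y c by blast
qed

text \<open>The directions at \<open>toggle i r\<close> span a cell by \<open>subcell\<close>, with
  far end \<open>t\<close>. It turns out that \<open>t = toggle i y\<close>, so this cell is all of
  \<open>Z\<close>.\<close>

lemma cell_toggle:
  assumes c: "cell Z r y" and i: "i \<in> nb Z r"
  shows "cell Z (toggle i r) (toggle i y)"
proof -
  let ?r = "toggle i r" and ?y = "toggle i y"
  have sp: "spans Z r y" using c by (simp add: cell_def)
  have Z: "finite Z" "peano_family Z" "iso_family Z" "r \<in> Z" "y \<in> Z" "\<And>z. z \<in> Z \<Longrightarrow> btw r y z"
    using sp by (auto simp: spans_def peano_family_def)
  have rZ: "?r \<in> Z" and yZ: "?y \<in> Z"
    using c i by (auto simp: cell_def nb_def)
  have all: "btw ?r ?y z" if "z \<in> Z" for z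
    using Z(6)[OF that] Z(6)[OF rZ] unfolding btw_def by (auto split: if_splits)
  have sp': "spans Z ?r ?y"
    using Z rZ yZ all by (auto simp: spans_def)
  have opp: "(j \<in> ?y) \<noteq> (j \<in> ?r)" if "j \<in> nb Z ?r" for j
    using spans_differ[OF sp' rZ, of "toggle j ?r" j] that by (auto simp: nb_def)
  obtain t where t: "t \<in> Z" "cell (seg Z ?r t) ?r t" "nb (seg Z ?r t) ?r = nb Z ?r"
    "\<forall>j\<in>nb Z ?r. (j \<in> t) \<noteq> (j \<in> ?r)"
    by (rule subcell[OF Z(1,2) rZ subset_refl yZ opp])
  have i': "i \<in> nb Z ?r" using Z by (simp add: nb_def)
  have "toggle i t \<in> seg Z ?r t"
    using i' t(2,3) by (auto simp: cell_def nb_def)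
  then have tZ: "toggle i t \<in> Z" by (simp add: seg_def)
  have "toggle i t = y"
  proof (rule agree_on_nb[OF Z(3) tZ Z(5)])
    fix j assume "j \<in> nb Z y"
    then have j: "j \<in> nb Z r" using c by (simp add: cell_def)
    then have jr: "toggle j r \<in> Z" by (simp add: nb_def)
    have jy: "(j \<in> r) \<noteq> (j \<in> y)"
      using spans_differ[OF sp Z(4) jr, of j] by auto
    show "(j \<in> toggle i t) = (j \<in> y)"
    proof (cases "j = i")
      case True
      then show ?thesis using bspec[OF t(4) i'] jy by auto
    next
      case False
      show ?thesis
      proof (rule ccontr)
        assume "\<not> ?thesis"
        then have "(j \<in> t) = (j \<in> r)" using jy False by auto
        \<comment> \<open>Stability for \<open>j\<close> places \<open>?r\<close> between
          \<open>t\<close> and a boundary vertex \<open>w\<close>. But \<open>t\<close> differs from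
          \<open>?r\<close> in every direction at \<open>?r\<close>, so a first step from
          \<open>?r\<close> to \<open>w\<close> is impossible, and \<open>w = ?r\<close> would make
          \<open>j\<close> such a direction.\<close>
        then obtain w where w: "w \<in> Z" "toggle j w \<in> Z" "(j \<in> w) = (j \<in> r)" "btw t w ?r"
          using spans_stable[OF sp jr t(1) rZ] False by auto
        show False
        proof (cases "w = ?r")
          case True
          then show False using w(2) bspec[OF t(4), of j] \<open>(j \<in> t) = (j \<in> r)\<close> False by (auto simp: nb_def)
        next
          case ne: False
          then obtain l where l: "(l \<in> ?r) \<noteq> (l \<in> w)" "toggle l ?r \<in> Z"
            using iso_family_step[OF Z(3) rZ w(1)] by metis
          then have "(l \<in> t) \<noteq> (l \<in> ?r)" using bspec[OF t(4), of l] by (simp add: nb_def)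
          then have "(l \<in> t) = (l \<in> w)" using l(1) by blast
          then show False using w(4) l(1) \<open>(l \<in> t) \<noteq> (l \<in> ?r)\<close> unfolding btw_def by blast
        qed
      qed
    qed
  qed
  then have ty: "t = ?y" by auto
  have "seg Z ?r t = Z" using all ty by (auto simp: seg_def)
  then show ?thesis using t(2) ty by simp
qed

section \<open>Antipodality\<close>

definition antipodal :: "'i set set \<Rightarrow> bool" where
  "antipodal A \<longleftrightarrow> (\<forall>v\<in>A. \<exists>t\<in>A. \<forall>z\<in>A. btw v t z)"

text \<open>The antipode of \<open>toggle e v\<close> must be \<open>toggle e t\<close>: an antipode
  differs from its vertex exactly in the coordinates that vary on \<open>A\<close>.\<close>

lemma antipodal_toggle:
  assumes A: "antipodal A" and v: "v \<in> A" "t \<in> A" "toggle e v \<in> A"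
    and bt: "\<And>z. z \<in> A \<Longrightarrow> btw v t z"
  shows "toggle e t \<in> A"
proof -
  obtain s where s: "s \<in> A" "\<And>z. z \<in> A \<Longrightarrow> btw (toggle e v) s z"
    using A v(3) unfolding antipodal_def by blast
  have "s = toggle e t"
  proof (rule set_eqI)
    fix i
    have 1: "btw v t (toggle e v)" "btw v t s" using bt v(3) s(1) by blast+
    have 2: "btw (toggle e v) s v" "btw (toggle e v) s t" using s(2) v by blast+
    show "(i \<in> s) = (i \<in> toggle e t)"
    proof (cases "i = e")
      case True
      have "(e \<in> v) \<noteq> (e \<in> t)" using btwD[OF 1(1), of e] by auto
      moreover have "(e \<in> toggle e v) \<noteq> (e \<in> s)" using btwD[OF 2(1), of e] by auto
      ultimately show ?thesis using True by auto
    next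
      case False
      show ?thesis
      proof (cases "(i \<in> v) = (i \<in> t)")
        case True
        then show ?thesis using btwD[OF 1(2), of i] False by simp
      next
        case vt: False
        then have "(i \<in> toggle e v) \<noteq> (i \<in> s)" using btwD[OF 2(2), of i] False by auto
        then show ?thesis using vt False by auto
      qed
    qed
  qed
  then show ?thesis using s(1) by simp
qed

text \<open>Every \<open>v\<close> is reached from \<open>r\<close> along a geodesic, and
  \<open>cell_toggle\<close> carries both ends of the cell along each edge.\<close>

lemma cell_antipodal:
  assumes "cell Z r y"
  shows "antipodal Z"
proof -
  have "\<exists>t. cell Z v t" if "v \<in> Z" for v
    using that
  proof (induction "hdist v r" arbitrary: v rule: less_induct)
    case less
    have Z: "iso_family Z" "r \<in> Z"
      using assms by (auto simp: cell_def spans_def peano_family_def)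
    show ?case
    proof (cases "v = r")
      case True
      then show ?thesis using assms by blast
    next
      case False
      then obtain i where i: "(i \<in> v) \<noteq> (i \<in> r)" "toggle i v \<in> Z"
        using iso_family_step[OF Z(1) less.prems Z(2)] by metis
      have "hdist (toggle i v) r < hdist v r"
        using hdist_toggle[OF _ _ i(1)] iso_family_finite[OF Z(1)] less.prems Z(2) by auto
      then obtain t where "cell Z (toggle i v) t" using less.hyps i(2) by blast
      then have "cell Z v (toggle i t)"
        using cell_toggle[of Z "toggle i v" t i] less.prems by (simp add: nb_def)
      then show ?thesis by blast
    qed
  qed
  then show ?thesis unfolding antipodal_def cell_def spans_def by metis
qed

section \<open>Antipodal convex families are gated\<close>

text \<open>For nonempty \<open>S\<close>, the trace on \<open>G\<close> of the smallest subcube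
  containing \<open>S\<close>. Described by coordinates, it is visibly convex, and finite when
  \<open>S\<close> is a finite set of finite sets.\<close>

definition hull_family :: "'i set set \<Rightarrow> 'i set set \<Rightarrow> 'i set set" where
  "hull_family G S = {z \<in> G. \<forall>i. (\<forall>a\<in>S. \<forall>b\<in>S. (i \<in> a) = (i \<in> b)) \<longrightarrow> (\<forall>a\<in>S. (i \<in> z) = (i \<in> a))}"

lemma hull_family_superset:
  assumes "S \<subseteq> G"
  shows "S \<subseteq> hull_family G S"
proof
  fix z assume z: "z \<in> S"
  have "(i \<in> z) = (i \<in> a)" if "\<forall>a\<in>S. \<forall>b\<in>S. (i \<in> a) = (i \<in> b)" "a \<in> S" for i a
    using bspec[OF bspec[OF that(1) z] that(2)] .
  then show "z \<in> hull_family G S"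
    unfolding hull_family_def using z assms by (intro CollectI conjI allI impI ballI) (rule subsetD)
qed

lemma hull_familyD:
  assumes "z \<in> hull_family G S" "\<forall>a\<in>S. \<forall>b\<in>S. (i \<in> a) = (i \<in> b)" "a \<in> S"
  shows "(i \<in> z) = (i \<in> a)"
  using assms(1)[unfolded hull_family_def, THEN CollectD, THEN conjunct2, THEN spec, THEN mp, OF assms(2)]
  by (rule bspec) (fact assms(3))

lemma convex_hull_family: "convex_family G (hull_family G S)"
proof (rule convex_familyI)
  show "hull_family G S \<subseteq> G" unfolding hull_family_def by (rule Collect_restrict)
next
  fix x y z assume *: "x \<in> hull_family G S" "y \<in> hull_family G S" "z \<in> G" "btw x y z"
  have "(i \<in> z) = (i \<in> a)" if "\<forall>a\<in>S. \<forall>b\<in>S. (i \<in> a) = (i \<in> b)" "a \<in> S" for i a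
  proof -
    have "(i \<in> x) = (i \<in> a)" "(i \<in> y) = (i \<in> a)"
      by (rule hull_familyD[OF *(1) that], rule hull_familyD[OF *(2) that])
    then show ?thesis using btwD[OF *(4), of i] by blast
  qed
  then show "z \<in> hull_family G S"
    using *(3) unfolding hull_family_def by (intro CollectI conjI allI impI ballI) assumption+
qed

lemma finite_hull_family:
  assumes "finite S" "S \<noteq> {}" "\<And>s. s \<in> S \<Longrightarrow> finite s"
  shows "finite (hull_family G S)"
proof (rule finite_subset)
  show "hull_family G S \<subseteq> Pow (\<Union>S)"
  proof
    fix z assume z: "z \<in> hull_family G S"
    have "i \<in> \<Union>S" if "i \<in> z" for i
    proof (rule ccontr)
      assume "i \<notin> \<Union>S"
      then have "\<forall>a\<in>S. \<forall>b\<in>S. (i \<in> a) = (i \<in> b)" by blast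
      then have "(i \<in> z) = (i \<in> a)" if "a \<in> S" for a
        using hull_familyD[OF z] that by blast
      then show False using that \<open>i \<notin> \<Union>S\<close> assms(2) by blast
    qed
    then show "z \<in> Pow (\<Union>S)" by blast
  qed
  show "finite (Pow (\<Union>S))" using assms by auto
qed

text \<open>Induction on the distance from \<open>x\<close> to a fixed member \<open>a0\<close>: the
  gate \<open>y\<close> of a neighbour \<open>toggle e x\<close> closer to \<open>a0\<close> yields
  the gate of \<open>x\<close>, which is \<open>y\<close> if \<open>e\<close> separates
  \<open>x\<close> from \<open>A\<close>, and \<open>toggle e y\<close> otherwise.\<close>

lemma antipodal_gated:
  assumes G: "peano_family G" and A: "finite A" "convex_family G A" "A \<noteq> {}" "antipodal A"
    and x: "x \<in> G"
  shows "\<exists>y\<in>A. \<forall>z\<in>A. btw x z y"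
proof -
  have iso: "iso_family G" using G by (simp add: peano_family_def)
  have AG: "A \<subseteq> G" using A convex_family_subset by blast
  have fin: "finite z" if "z \<in> G" for z using iso_family_finite[OF iso that] .
  obtain a0 where a0: "a0 \<in> A" using A by blast
  show ?thesis using x a0
  proof (induction "hdist x a0" arbitrary: x rule: less_induct)
    case less
    show ?case
    proof (cases "x = a0")
      case True
      then show ?thesis using less.prems(2) by (auto simp: btw_def)
    next
      case False
      obtain e where e: "(e \<in> x) \<noteq> (e \<in> a0)" "toggle e x \<in> G"
        using iso_family_step[OF iso less.prems(1) _ False] AG less.prems(2) by blast
      let ?x = "toggle e x"
      have "hdist ?x a0 < hdist x a0"
        using hdist_toggle[OF _ _ e(1)] fin less.prems AG by auto
      from less.hyps[OF this e(2) less.prems(2)] obtain y where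
        y: "y \<in> A" "\<And>z. z \<in> A \<Longrightarrow> btw ?x z y" by blast
      \<comment> \<open>Off \<open>e\<close>, the gate takes the side of \<open>x\<close> as soon as
        some member of \<open>A\<close> is on it.\<close>
      have off: "(i \<in> y) = (i \<in> x)" if "i \<noteq> e" "z \<in> A" "(i \<in> z) = (i \<in> x)" for i z
        using btwD[OF y(2)[OF that(2)], of i] that(1,3) by auto
      show ?thesis
      proof (cases "\<exists>b\<in>A. (e \<in> b) = (e \<in> x)")
        case False
        then have "btw x z y" if "z \<in> A" for z
          unfolding btw_def using off[OF _ that] that y(1) by metis
        then show ?thesis using y(1) by blast
      next
        case True
        then obtain b where b: "b \<in> A" "(e \<in> b) = (e \<in> x)" by blast
        have ye: "(e \<in> y) \<noteq> (e \<in> x)"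
          using btwD[OF y(2)[OF less.prems(2)], of e] e(1) by auto
        \<comment> \<open>It suffices to put \<open>toggle e r\<close> into \<open>A\<close> for the
          antipode \<open>r\<close> of \<open>y\<close>.\<close>
        have "toggle e y \<in> A"
        proof -
          obtain r where r: "r \<in> A" "\<And>z. z \<in> A \<Longrightarrow> btw y r z"
            using A(4)[unfolded antipodal_def] y(1) by blast
          have re: "(e \<in> r) = (e \<in> x)"
            using btwD[OF r(2)[OF b(1)], of e] b(2) ye by blast
          define H where "H = hull_family G (insert x A)"
          have SH: "insert x A \<subseteq> H"
            unfolding H_def by (rule hull_family_superset) (use AG less.prems(1) in simp)
          have Hc: "convex_family G H" unfolding H_def by (rule convex_hull_family)
          have Hf: "finite H"
            unfolding H_def using A(1) fin AG less.prems by (intro finite_hull_family) auto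
          have hs: "hull_stable H" using G Hc Hf by (simp add: peano_family_def)
          have x'H: "?x \<in> H"
            by (rule convex_familyD[OF Hc, of x a0]) (use SH less.prems e in \<open>auto simp: btw_def\<close>)
          have isoA: "iso_family A" using iso_family_convex[OF iso A(2)] .
          \<comment> \<open>\<open>c\<close> and the antipode \<open>t\<close> of
            \<open>toggle e c\<close> are both on the \<open>e\<close>-boundary of \<open>A\<close>
            on the side of \<open>x\<close>, and \<open>r\<close> lies between them. As
            \<open>x\<close> itself is on the boundary in \<open>H\<close>, stability applies to
            \<open>x\<close> and \<open>r\<close>.\<close>
          obtain c where c: "c \<in> A" "toggle e c \<in> A" "(e \<in> c) = (e \<in> x)"
            using crossing_edge[OF isoA b(1) y(1), of e] ye b(2) by metis
          obtain t where t: "t \<in> A" "\<And>z. z \<in> A \<Longrightarrow> btw (toggle e c) t z"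
            using A(4)[unfolded antipodal_def] c(2) by blast
          have te: "(e \<in> t) = (e \<in> x)"
            using btwD[OF t(2)[OF c(1)], of e] c(3) by auto
          have tA: "toggle e t \<in> A"
            using antipodal_toggle[OF A(4) c(2) t(1) _ t(2)] c(1) by simp
          have rc: "btw c t r"
            unfolding btw_def
          proof (intro allI impI)
            fix i assume "(i \<in> c) = (i \<in> t)"
            then show "(i \<in> r) = (i \<in> c)"
              using btwD[OF t(2)[OF r(1)], of i] re c(3) by (cases "i = e") auto
          qed
          obtain u where u: "u \<in> H" "toggle e u \<in> H" "(e \<in> u) = (e \<in> x)" "btw x u r"
            by (rule hull_stableD[OF hs, of x r e x x c t])
              (use SH x'H r(1) re c te tA t(1) rc in \<open>auto simp: btw_def\<close>)
          \<comment> \<open>Only coordinates constant on \<open>A\<close> can exclude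
            \<open>w\<close> from \<open>A\<close>; those shared by \<open>x\<close> are controlled
            by membership in \<open>H\<close>, the others by the assumption
            \<open>ag\<close>.\<close>
          have inA: "w \<in> A" if "w \<in> H" and
            ag: "\<And>i. (\<forall>a\<in>A. \<forall>b\<in>A. (i \<in> a) = (i \<in> b)) \<Longrightarrow> (i \<in> x) \<noteq> (i \<in> r) \<Longrightarrow> (i \<in> w) = (i \<in> r)" for w
          proof (rule convex_family_separation[OF iso A(2,3)])
            show "w \<in> G" using that(1) convex_family_subset[OF Hc] by blast
            fix i assume i: "\<forall>a\<in>A. \<forall>b\<in>A. (i \<in> a) = (i \<in> b)"
            show "\<forall>a\<in>A. (i \<in> w) = (i \<in> a)"
            proof (cases "(i \<in> x) = (i \<in> r)")
              case True
              then have "\<forall>a\<in>insert x A. \<forall>b\<in>insert x A. (i \<in> a) = (i \<in> b)"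
                using i r(1) by blast
              then show ?thesis using hull_familyD[OF that(1)[unfolded H_def]] by blast
            next
              case False
              then show ?thesis using ag[OF i False] i r(1) by blast
            qed
          qed
          have ur: "(i \<in> u) = (i \<in> r)" if "(i \<in> x) \<noteq> (i \<in> r)" for i
            using u(4) that unfolding btw_def by blast
          have uA: "u \<in> A" using inA[OF u(1)] ur by blast
          have uA': "toggle e u \<in> A"
            by (rule inA[OF u(2)]) (use ur re in auto)
          \<comment> \<open>Where \<open>x\<close> and \<open>r\<close> agree off \<open>e\<close>,
            so do \<open>y\<close> and \<open>r\<close>; as these are antipodes, all of
            \<open>A\<close>, including \<open>u\<close>, agrees there.\<close>
          have "u = r"
          proof (rule set_eqI)
            fix i
            show "(i \<in> u) = (i \<in> r)"
            proof (cases "(i \<in> x) = (i \<in> r)")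
              case False then show ?thesis using ur by blast
            next
              case True
              show ?thesis
              proof (cases "i = e")
                case True then show ?thesis using u(3) re by simp
              next
                case False
                then have "(i \<in> y) = (i \<in> r)" using off[OF False r(1)] True by auto
                then show ?thesis using r(2)[OF uA] unfolding btw_def by blast
              qed
            qed
          qed
          then have "toggle e r \<in> A" using uA' by simp
          then show ?thesis
            using antipodal_toggle[OF A(4) r(1) y(1)] r(2) btw_commute by blast
        qed
        moreover have "btw x z (toggle e y)" if "z \<in> A" for z
          unfolding btw_def using off[OF _ that] ye by auto
        ultimately show ?thesis by blast
      qed
    qed
  qed
qed

section \<open>Regular convex families are antipodal\<close>

text \<open>
  For a second direction \<open>j\<close> at \<open>r\<close>, the two-dimensional cell spanned by \<open>i\<close> and \<open>j\<close> has an edge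
  at \<open>toggle i r\<close> of some direction \<open>M j \<noteq> i\<close>. Gatedness of these cells makes \<open>M\<close> injective.
\<close>
lemma cell_degree:
  assumes c: "cell Z r y" and i: "i \<in> nb Z r"
  shows "card (nb Z r) \<le> card (nb Z (toggle i r))"
proof -
  let ?r = "toggle i r"
  have sp: "spans Z r y" using c by (simp add: cell_def)
  have Z: "finite Z" "peano_family Z" "iso_family Z" "r \<in> Z" "y \<in> Z" "?r \<in> Z"
    using sp i by (auto simp: spans_def peano_family_def nb_def)
  have opp: "(j \<in> y) \<noteq> (j \<in> r)" if "j \<in> nb Z r" for j
    using spans_differ[OF sp Z(4), of "toggle j r" j] that by (auto simp: nb_def)
  have "\<exists>t m. t \<in> Z \<and> cell (seg Z r t) r t \<and> nb (seg Z r t) r = {i, j} \<and>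
      (i \<in> t) \<noteq> (i \<in> r) \<and> (j \<in> t) \<noteq> (j \<in> r) \<and> m \<in> nb Z ?r \<and> m \<noteq> i \<and> (m \<in> t) \<noteq> (m \<in> r)"
    if j: "j \<in> nb Z r - {i}" for j
  proof -
    have D: "{i, j} \<subseteq> nb Z r" using i j by blast
    obtain t where t: "t \<in> Z" "cell (seg Z r t) r t" "nb (seg Z r t) r = {i, j}"
      "\<forall>l\<in>{i, j}. (l \<in> t) \<noteq> (l \<in> r)"
      by (rule subcell[OF Z(1,2,4) D Z(5) opp]) (use D in blast)
    have "(j \<in> t) \<noteq> (j \<in> ?r)" using t(4) j by auto
    then have "?r \<noteq> t" by blast
    then obtain m where m: "(m \<in> ?r) \<noteq> (m \<in> t)" "toggle m ?r \<in> Z"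
      using iso_family_step[OF Z(3,6) t(1)] by metis
    have "m \<noteq> i" using m(1) t(4) by auto
    then have "(m \<in> t) \<noteq> (m \<in> r)" using m(1) by auto
    moreover have "m \<in> nb Z ?r" using m(2) by (simp add: nb_def)
    ultimately show ?thesis using t(1-3) bspec[OF t(4), of i] bspec[OF t(4), of j] \<open>m \<noteq> i\<close> by blast
  qed
  then obtain T M where TM: "\<And>j. j \<in> nb Z r - {i} \<Longrightarrow> T j \<in> Z \<and> cell (seg Z r (T j)) r (T j) \<and>
      nb (seg Z r (T j)) r = {i, j} \<and> (i \<in> T j) \<noteq> (i \<in> r) \<and> (j \<in> T j) \<noteq> (j \<in> r) \<and>
      M j \<in> nb Z ?r \<and> M j \<noteq> i \<and> (M j \<in> T j) \<noteq> (M j \<in> r)"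
    by metis
  have "inj_on M (nb Z r - {i})"
  proof (rule inj_onI, rule ccontr)
    fix j l assume j: "j \<in> nb Z r - {i}" and l: "l \<in> nb Z r - {i}" and m: "M j = M l" and "j \<noteq> l"
    let ?m = "M j" and ?A = "seg Z r (T j)" and ?B = "seg Z r (T l)"
    note J = TM[OF j] and L = TM[OF l]
    \<comment> \<open>\<open>?t\<close> is back on the \<open>i\<close>-side of \<open>r\<close> but
      still across \<open>?m\<close>. Its gate \<open>g\<close> in \<open>?A\<close> shares both
      properties, so it is not \<open>r\<close> and must be across \<open>j\<close>, the only other
      direction of \<open>?A\<close> at \<open>r\<close>. Hence \<open>T l\<close> is across
      \<open>j\<close> too, making \<open>j\<close> a direction of \<open>?B\<close> at
      \<open>r\<close>.\<close>
    let ?t = "toggle i (T l)"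
    have "?t \<in> ?B"
      using L by (auto simp: cell_def nb_def)
    then have tZ: "?t \<in> Z" by (simp add: seg_def)
    have rA: "r \<in> ?A" "T j \<in> ?A" using seg_ends Z(4) J by blast+
    have "finite ?A" using Z(1) by (simp add: seg_def)
    moreover have "antipodal ?A" using J cell_antipodal by blast
    moreover have isoA: "iso_family ?A" using iso_family_convex[OF Z(3) convex_seg] .
    ultimately obtain g where g: "g \<in> ?A" "\<And>z. z \<in> ?A \<Longrightarrow> btw ?t z g"
      using antipodal_gated[OF Z(2) _ convex_seg _ _ tZ, of r "T j"] rA by blast
    have gi: "(i \<in> g) = (i \<in> r)"
      using btwD[OF g(2)[OF rA(1)], of i] L by auto
    have "(?m \<in> g) \<noteq> (?m \<in> r)"
      using btwD[OF g(2)[OF rA(2)], of ?m] J L m by auto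
    then have "g \<noteq> r" by blast
    then have "(j \<in> g) \<noteq> (j \<in> r)"
      using agree_on_nb[OF isoA g(1) rA(1)] J gi by (metis insertE singletonD)
    then have "(j \<in> ?t) \<noteq> (j \<in> r)"
      using btwD[OF g(2)[OF rA(1)], of j] by blast
    then have "(j \<in> T l) \<noteq> (j \<in> r)" using j by auto
    then have "toggle j r \<in> ?B"
      using j by (auto simp: nb_def seg_def btw_def)
    then have "j \<in> {i, l}" using L by (auto simp: nb_def)
    then show False using j \<open>j \<noteq> l\<close> by auto
  qed
  moreover have "M ` (nb Z r - {i}) \<subseteq> nb Z ?r - {i}" using TM by blast
  ultimately have "card (nb Z r - {i}) \<le> card (nb Z ?r - {i})"
    using card_inj_on_le finite_nb[OF Z(1)] by blast
  moreover have "i \<in> nb Z ?r" using Z(4) by (simp add: nb_def)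
  ultimately show ?thesis
    using i card.remove[OF finite_nb[OF Z(1)]] by (metis Suc_le_mono)
qed

lemma regular_antipodal:
  assumes A: "finite A" "peano_family A" "\<And>v. v \<in> A \<Longrightarrow> card (nb A v) = k"
  shows "antipodal A"
proof (cases "A = {}")
  case True
  then show ?thesis by (simp add: antipodal_def)
next
  case False
  then obtain y0 where y0: "y0 \<in> A" by blast
  have iso: "iso_family A" using A(2) by (simp add: peano_family_def)
  note fin = iso_family_finite[OF iso]
  obtain r where r: "r \<in> A" "\<And>z. z \<in> A \<Longrightarrow> hdist y0 z \<le> hdist y0 r"
    using Max_in[of "hdist y0 ` A"] Max_ge[of "hdist y0 ` A"] A(1) False by fastforce
  \<comment> \<open>\<open>r\<close> is farthest from \<open>y0\<close>, so no edge at
    \<open>r\<close> leads away from \<open>y0\<close>: \<open>y0\<close> is across all directions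
    at \<open>r\<close>.\<close>
  have "(i \<in> y0) \<noteq> (i \<in> r)" if i: "i \<in> nb A r" for i
  proof
    assume "(i \<in> y0) = (i \<in> r)"
    then have "hdist y0 (toggle i r) = Suc (hdist y0 r)"
      using hdist_toggle'[of y0 "toggle i r" i] fin y0 r(1) by auto
    then show False using r(2)[of "toggle i r"] i by (auto simp: nb_def)
  qed
  then have opp: "\<And>i. i \<in> nb A r \<Longrightarrow> (i \<in> y0) \<noteq> (i \<in> r)" .
  obtain y where "y \<in> A" and y: "cell (seg A r y) r y" "nb (seg A r y) r = nb A r"
    and "\<forall>i\<in>nb A r. (i \<in> y) \<noteq> (i \<in> r)"
    by (rule subcell[OF A(1,2) r(1) subset_refl y0 opp])
  let ?Z = "seg A r y"
  have ZA: "?Z \<subseteq> A" by (auto simp: seg_def)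
  have "\<exists>t. cell ?Z v t \<and> nb ?Z v = nb A v" if "v \<in> A" for v
    using that
  proof (induction "hdist v r" arbitrary: v rule: less_induct)
    case less
    show ?case
    proof (cases "v = r")
      case True
      then show ?thesis using y by blast
    next
      case False
      then obtain i where i: "(i \<in> v) \<noteq> (i \<in> r)" "toggle i v \<in> A"
        using iso_family_step[OF iso less.prems r(1)] by metis
      have "hdist (toggle i v) r < hdist v r"
        using hdist_toggle[OF _ _ i(1)] fin less.prems r(1) by auto
      from less.hyps[OF this i(2)] obtain t where
        t: "cell ?Z (toggle i v) t" "nb ?Z (toggle i v) = nb A (toggle i v)" by blast
      have ii: "i \<in> nb ?Z (toggle i v)"
        unfolding t(2) using less.prems by (simp add: nb_def)
      have "cell ?Z v (toggle i t)"
        using cell_toggle[OF t(1) ii] by simp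
      \<comment> \<open>Degrees in \<open>?Z\<close> do not drop along the edge, while
        \<open>k\<close> is the degree in \<open>A\<close>; so no edge of \<open>A\<close> at
        \<open>v\<close> is missing from \<open>?Z\<close>.\<close>
      moreover have "k \<le> card (nb ?Z v)"
        using cell_degree[OF t(1) ii] t(2) A(3)[OF i(2)] by simp
      then have "nb ?Z v = nb A v"
        using card_seteq[OF finite_nb[OF A(1)] nb_mono[OF ZA]] A(3)[OF less.prems] by metis
      ultimately show ?thesis by blast
    qed
  qed
  then have "A \<subseteq> ?Z" by (auto simp: cell_def spans_def)
  then have "?Z = A" using ZA by blast
  then show ?thesis using cell_antipodal[OF y(1)] by simp
qed

section \<open>From copoints to hull stability\<close>

text \<open>An edge crossing \<open>e\<close> inside \<open>D\<close> gives a boundary vertex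
  \<open>u\<close> of \<open>D\<close>; \<open>a\<close> lies between \<open>u\<close> and
  \<open>toggle e a\<close>, which is in \<open>D\<close>.\<close>

lemma boundary_in_convex:
  assumes iso: "iso_family F" and D: "convex_family F D" and W: "{w \<in> F. (e \<in> w) \<noteq> (e \<in> d)} \<subseteq> D"
    and d: "d \<in> D" and a: "a \<in> F" "toggle e a \<in> F" "(e \<in> a) = (e \<in> d)"
  shows "a \<in> D"
proof -
  have a': "toggle e a \<in> D" using W a by auto
  obtain u where u: "u \<in> D" "toggle e u \<in> D" "(e \<in> u) = (e \<in> d)"
    using crossing_edge[OF iso_family_convex[OF iso D] d a', of e] a(3) by auto
  have "btw u (toggle e a) a"
    using u(3) a(3) by (auto simp: btw_def)
  then show ?thesis using convex_familyD[OF D u(1) a' a(1)] by blast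
qed

text \<open>The half-space \<open>W\<close> opposite to \<open>x\<close> is a copoint at
  \<open>x\<close>: a larger convex set contains the whole boundary of the side of \<open>x\<close>,
  hence \<open>a\<close>, \<open>b\<close> and \<open>x\<close>. Likewise every convex set
  containing \<open>x\<close> and \<open>W\<close> contains \<open>c\<close>, \<open>d\<close> and
  \<open>v\<close>, so one interval step from \<open>insert x W\<close> reaches
  \<open>v\<close>.\<close>

lemma hull_stable_if_copoints:
  assumes iso: "iso_family F"
    and ph: "\<And>x W v. x \<in> F \<Longrightarrow> convex_family F W \<Longrightarrow> x \<notin> W \<Longrightarrow>
      (\<And>D. convex_family F D \<Longrightarrow> W \<subseteq> D \<Longrightarrow> x \<notin> D \<Longrightarrow> D = W) \<Longrightarrow> v \<in> F \<Longrightarrow>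
      (\<And>D. convex_family F D \<Longrightarrow> insert x W \<subseteq> D \<Longrightarrow> v \<in> D) \<Longrightarrow>
      \<exists>p\<in>insert x W. \<exists>q\<in>insert x W. btw p q v"
  shows "hull_stable F"
  unfolding hull_stable_def
proof (intro allI impI)
  fix e x v a b c d
  assume F: "{x, v, a, b, c, d} \<subseteq> F" "{toggle e a, toggle e b, toggle e c, toggle e d} \<subseteq> F"
    and side: "(e \<in> v) = (e \<in> x)" "(e \<in> a) = (e \<in> x)" "(e \<in> b) = (e \<in> x)" "(e \<in> c) = (e \<in> x)" "(e \<in> d) = (e \<in> x)"
    and bt: "btw a b x" "btw c d v"
  define W where "W = {w \<in> F. (e \<in> w) \<noteq> (e \<in> x)}"
  have Wc: "convex_family F W"
  proof (rule convex_familyI)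
    show "W \<subseteq> F" by (auto simp: W_def)
    fix p q z assume "p \<in> W" "q \<in> W" "z \<in> F" "btw p q z"
    then show "z \<in> W" using btwD[of p q z e] by (auto simp: W_def)
  qed
  have full: "s \<in> D" if D: "convex_family F D" "W \<subseteq> D" and g: "g \<in> D" "g \<notin> W"
    and s: "s \<in> F" "toggle e s \<in> F" "(e \<in> s) = (e \<in> x)" for D g s
  proof -
    have "g \<in> F" using convex_family_subset[OF D(1)] g(1) by blast
    then have eg: "(e \<in> g) = (e \<in> x)" using g(2) by (auto simp: W_def)
    show ?thesis
      by (rule boundary_in_convex[OF iso D(1) _ g(1) s(1,2)]) (use D(2) eg s(3) in \<open>auto simp: W_def\<close>)
  qed
  have "\<exists>p\<in>insert x W. \<exists>q\<in>insert x W. btw p q v"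
  proof (rule ph[OF _ Wc])
    show "x \<in> F" "v \<in> F" using F by auto
    show "x \<notin> W" by (simp add: W_def)
    fix D assume D: "convex_family F D"
    show "D = W" if WD: "W \<subseteq> D" and xD: "x \<notin> D"
    proof (rule ccontr)
      assume "D \<noteq> W"
      then obtain g where g: "g \<in> D" "g \<notin> W" using WD by blast
      have "a \<in> D" "b \<in> D" using full[OF D WD g] F side by simp_all
      then show False using convex_familyD[OF D _ _ _ bt(1)] F(1) xD by blast
    qed
    show "v \<in> D" if xW: "insert x W \<subseteq> D"
    proof -
      have WD: "W \<subseteq> D" and xD: "x \<in> D" using xW by auto
      have xW: "x \<notin> W" by (simp add: W_def)
      have "c \<in> D" "d \<in> D" using full[OF D WD xD xW] F side by simp_all
      then show ?thesis using convex_familyD[OF D _ _ _ bt(2)] F(1) by blast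
    qed
  qed
  then obtain p q where pq: "p \<in> insert x W" "q \<in> insert x W" "btw p q v" by blast
  \<comment> \<open>Not both ends lie in the convex set \<open>W\<close>, as \<open>v\<close> does
    not; if both are \<open>x\<close>, then \<open>v = x\<close> and \<open>toggle e a\<close>
    serves as \<open>w\<close>.\<close>
  have "\<exists>w\<in>W. btw x w v"
  proof (cases "p = x")
    case True
    show ?thesis
    proof (cases "q = x")
      case qx: True
      then have "v = x" using pq(3) True by (auto simp: btw_def)
      moreover have "toggle e a \<in> W" using F side by (auto simp: W_def)
      ultimately show ?thesis by (auto simp: btw_def)
    next
      case False
      then show ?thesis using pq True by blast
    qed
  next
    case False
    then have p: "p \<in> W" using pq(1) by blast
    have "q = x"
    proof (rule ccontr)
      assume "q \<noteq> x"
      then have "q \<in> W" using pq(2) by blast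
      then show False using btwD[OF pq(3), of e] p side(1) by (auto simp: W_def)
    qed
    then show ?thesis using pq(3) p btw_commute by blast
  qed
  then obtain w where w: "w \<in> W" "btw x w v" by blast
  \<comment> \<open>A geodesic from \<open>v\<close> to \<open>w\<close> crosses \<open>e\<close> at
    \<open>u\<close>, and \<open>v\<close> remains between \<open>x\<close> and
    \<open>u\<close>.\<close>
  then obtain u where u: "u \<in> F" "toggle e u \<in> F" "(e \<in> u) = (e \<in> v)" "btw v w u"
    using crossing_edge[OF iso, of v w e] F(1) side(1) unfolding W_def by blast
  have "btw x u v"
    unfolding btw_def
  proof (intro allI impI)
    fix i assume "(i \<in> x) = (i \<in> u)"
    then show "(i \<in> v) = (i \<in> x)"
      using btwD[OF w(2), of i] btwD[OF u(4), of i] by blast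
  qed
  then show "\<exists>u\<in>F. toggle e u \<in> F \<and> (e \<in> u) = (e \<in> x) \<and> btw x u v"
    using u side(1) by blast
qed

section \<open>Partial cubes as isometric families\<close>

text \<open>The coordinates separating \<open>x\<close> from \<open>y\<close> form the symmetric
  difference of \<open>?A\<close> and \<open>?B\<close>, so equality in the triangle inequality
  means that \<open>?A\<close> and \<open>?B\<close> are disjoint.\<close>

lemma btw_iff_hdist:
  assumes "finite x" "finite y" "finite z"
  shows "btw x y z \<longleftrightarrow> hdist x z + hdist z y \<le> hdist x y"
proof -
  let ?A = "(x - z) \<union> (z - x)" and ?B = "(z - y) \<union> (y - z)" and ?C = "(x - y) \<union> (y - x)"
  have fin: "finite ?A" "finite ?B" "finite ?C" using assms by auto
  have sum: "card ?A + card ?B = card (?A \<union> ?B) + card (?A \<inter> ?B)"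
    using card_Un_Int[OF fin(1,2)] .
  have CAB: "?C \<subseteq> ?A \<union> ?B" by blast
  have bt: "btw x y z \<longleftrightarrow> ?A \<inter> ?B = {}"
    unfolding btw_def by blast
  show ?thesis
  proof
    assume "btw x y z"
    then have "?A \<inter> ?B = {}" using bt by blast
    moreover have "?A \<union> ?B \<subseteq> ?C" using calculation by blast
    then have "card (?A \<union> ?B) \<le> card ?C" by (rule card_mono[OF fin(3)])
    ultimately show "hdist x z + hdist z y \<le> hdist x y"
      using sum by (simp add: hdist_def)
  next
    assume "hdist x z + hdist z y \<le> hdist x y"
    moreover have "card ?C \<le> card (?A \<union> ?B)"
      using CAB fin by (intro card_mono) auto
    ultimately have "card (?A \<inter> ?B) = 0" using sum by (simp add: hdist_def)
    then have "?A \<inter> ?B = {}" using fin by (subst (asm) card_eq_0_iff) auto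
    then show "btw x y z" using bt by blast
  qed
qed

section \<open>Walks and geodesics\<close>

lemma gdist_le:
  assumes "walk V E xs" "hd xs = x" "last xs = y" "length xs = Suc n"
  shows "gdist V E x y \<le> n"
  unfolding gdist_def by (rule Least_le) (use assms in blast)

lemma gdist_walk:
  assumes "connected_graph V E" "x \<in> V" "y \<in> V"
  obtains xs where "walk V E xs" "hd xs = x" "last xs = y" "length xs = Suc (gdist V E x y)"
proof -
  obtain xs where xs: "walk V E xs" "hd xs = x" "last xs = y"
    using assms unfolding connected_graph_def by blast
  moreover have "length xs = Suc (length xs - 1)"
    using xs(1) by (cases xs) (auto simp: walk_def)
  ultimately have "\<exists>n xs. walk V E xs \<and> hd xs = x \<and> last xs = y \<and> length xs = Suc n"
    by blast
  from LeastI_ex[OF this] show ?thesis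
    using that unfolding gdist_def by blast
qed

lemma walk_take: "walk V E xs \<Longrightarrow> walk V E (take (Suc k) xs)"
  using set_take_subset[of "Suc k" xs] by (auto simp: walk_def)

lemma walk_drop: "walk V E xs \<Longrightarrow> k < length xs \<Longrightarrow> walk V E (drop k xs)"
  using set_drop_subset[of k xs] by (auto simp: walk_def)

lemma walk_append:
  assumes "walk V E xs" "walk V E ys" "last xs = hd ys"
  shows "walk V E (xs @ tl ys)"
proof -
  obtain y ys' where ys: "ys = y # ys'" using assms(2) by (cases ys) (auto simp: walk_def)
  have xs: "xs \<noteq> []" using assms(1) by (simp add: walk_def)
  have step: "E (ys ! j) (ys ! Suc j)" if "Suc j < length ys" for j
    using assms(2) that unfolding walk_def by blast
  have "E ((xs @ ys') ! i) ((xs @ ys') ! Suc i)" if i: "Suc i < length (xs @ ys')" for i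
  proof -
    consider "Suc i < length xs" | "Suc i = length xs" | "length xs \<le> i" by linarith
    then show ?thesis
    proof cases
      case 1
      then show ?thesis using assms(1) by (simp add: walk_def nth_append)
    next
      case 2
      then have "xs ! i = y" using assms(3) ys xs by (metis diff_Suc_1 last_conv_nth list.sel(1))
      moreover have "E (ys ! 0) (ys ! Suc 0)"
        by (rule step) (use i 2 ys in simp)
      ultimately show ?thesis using 2 ys by (simp add: nth_append)
    next
      case 3
      have "E (ys ! Suc (i - length xs)) (ys ! Suc (Suc (i - length xs)))"
        by (intro step) (use i 3 ys in simp)
      then show ?thesis using 3 ys by (simp add: nth_append Suc_diff_le)
    qed
  qed
  then show ?thesis using assms(1,2) ys by (auto simp: walk_def)
qed

lemma walk_nth_in: "walk V E xs \<Longrightarrow> k < length xs \<Longrightarrow> xs ! k \<in> V"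
  by (auto simp: walk_def)

lemma partial_cubeD:
  assumes "partial_cube_emb V E f"
  shows "graph V E" "connected_graph V E" "\<And>x. x \<in> V \<Longrightarrow> finite (f x)"
    "\<And>x y. x \<in> V \<Longrightarrow> y \<in> V \<Longrightarrow> gdist V E x y = hdist (f x) (f y)"
  using assms by (auto simp: partial_cube_emb_def hdist_def)

text \<open>Cutting a geodesic at \<open>z\<close>, and conversely joining geodesics at
  \<open>z\<close>, shows that membership means equality in the triangle inequality;
  \<open>btw_iff_hdist\<close> turns this into coordinates.\<close>

lemma interval_iff:
  assumes pc: "partial_cube_emb V E f" and xy: "x \<in> V" "y \<in> V"
  shows "z \<in> interval V E x y \<longleftrightarrow> z \<in> V \<and> btw (f x) (f y) (f z)"
proof
  note pcD = partial_cubeD[OF pc]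
  assume "z \<in> interval V E x y"
  then obtain xs where xs: "walk V E xs" "hd xs = x" "last xs = y"
    "length xs = Suc (gdist V E x y)" "z \<in> set xs"
    unfolding interval_def by blast
  then obtain k where k: "k < length xs" "xs ! k = z" by (metis in_set_conv_nth)
  have z: "z \<in> V" using walk_nth_in[OF xs(1) k(1)] k(2) by simp
  have "hd (take (Suc k) xs) = x" using xs(1,2) by (cases xs) (auto simp: walk_def)
  moreover have "last (take (Suc k) xs) = z" using k by (simp add: take_Suc_conv_app_nth)
  moreover have "length (take (Suc k) xs) = Suc k" using k(1) by simp
  ultimately have "gdist V E x z \<le> k" by (rule gdist_le[OF walk_take[OF xs(1)]])
  moreover have "gdist V E z y \<le> gdist V E x y - k"
    by (rule gdist_le[OF walk_drop[OF xs(1) k(1)]])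
      (use xs k in \<open>auto simp: hd_drop_conv_nth\<close>)
  ultimately have "hdist (f x) (f z) + hdist (f z) (f y) \<le> hdist (f x) (f y)"
    using pcD(4) xy z k xs(4) by simp
  then show "z \<in> V \<and> btw (f x) (f y) (f z)"
    using btw_iff_hdist pcD(3) xy z by blast
next
  note pcD = partial_cubeD[OF pc]
  assume z: "z \<in> V \<and> btw (f x) (f y) (f z)"
  obtain xs where xs: "walk V E xs" "hd xs = x" "last xs = z" "length xs = Suc (gdist V E x z)"
    using gdist_walk[OF pcD(2)] xy z by metis
  obtain ys where ys: "walk V E ys" "hd ys = z" "last ys = y" "length ys = Suc (gdist V E z y)"
    using gdist_walk[OF pcD(2)] xy z by metis
  let ?w = "xs @ tl ys"
  have ne: "xs \<noteq> []" "ys \<noteq> []" using xs ys by auto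
  have w: "walk V E ?w" using walk_append[OF xs(1) ys(1)] xs ys by simp
  have h: "hd ?w = x" using xs ne by simp
  have l: "last ?w = y" using xs(3) ys(2,3) ne by (cases ys) (auto simp: last_append)
  have len: "length ?w = Suc (gdist V E x z + gdist V E z y)" using xs ys by simp
  have "gdist V E x z + gdist V E z y \<le> gdist V E x y"
    using z xy pcD(4) btw_iff_hdist[OF pcD(3)[OF xy(1)] pcD(3)[OF xy(2)] pcD(3), of z] by simp
  moreover have "gdist V E x y \<le> gdist V E x z + gdist V E z y"
    using gdist_le[OF w h l len] .
  ultimately have "length ?w = Suc (gdist V E x y)" using len by simp
  moreover have "z \<in> set ?w" using xs(3) ne by auto
  ultimately show "z \<in> interval V E x y"
    using w h l unfolding interval_def by blast
qed

lemma partial_cube_inj: "partial_cube_emb V E f \<Longrightarrow> inj_on f V"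
proof (rule inj_onI)
  fix x y assume pc: "partial_cube_emb V E f" and xy: "x \<in> V" "y \<in> V" "f x = f y"
  obtain xs where "walk V E xs" "hd xs = x" "last xs = y" "length xs = Suc (gdist V E x y)"
    using gdist_walk[OF partial_cubeD(2)[OF pc]] xy by metis
  moreover have "gdist V E x y = 0"
    using partial_cubeD(4)[OF pc xy(1,2)] xy(3) by (simp add: hdist_def)
  ultimately show "x = y" by (cases xs) auto
qed

lemma hdist_eq_1:
  assumes "hdist x y = 1"
  obtains i where "y = toggle i x"
proof -
  obtain i where i: "(x - y) \<union> (y - x) = {i}"
    using assms card_1_singletonE unfolding hdist_def by blast
  have "y = toggle i x"
  proof (rule set_eqI)
    fix j
    have "((j \<in> x) \<noteq> (j \<in> y)) = (j = i)" using i by blast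
    then show "(j \<in> y) = (j \<in> toggle i x)" by auto
  qed
  then show ?thesis using that by blast
qed

lemma hdist_toggle_self: "hdist x (toggle i x) = 1"
proof -
  have "(x - toggle i x) \<union> (toggle i x - x) = {i}" by (auto split: if_splits)
  then show ?thesis by (simp add: hdist_def)
qed

lemma edge_iff_toggle:
  assumes pc: "partial_cube_emb V E f" and xy: "x \<in> V" "y \<in> V"
  shows "E x y \<longleftrightarrow> (\<exists>i. f y = toggle i (f x))"
proof
  note pcD = partial_cubeD[OF pc]
  assume E: "E x y"
  have "walk V E [x, y]" using E xy by (auto simp: walk_def less_Suc_eq)
  then have "gdist V E x y \<le> 1" by (rule gdist_le) auto
  moreover have "x \<noteq> y" using E pcD(1) by (auto simp: graph_def)
  then have "f x \<noteq> f y" using partial_cube_inj[OF pc] xy by (auto dest: inj_onD)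
  then have "hdist (f x) (f y) \<noteq> 0" using hdist_eq_0 pcD(3) xy by blast
  ultimately have "hdist (f x) (f y) = 1" using pcD(4) xy by simp
  then show "\<exists>i. f y = toggle i (f x)" using hdist_eq_1 by blast
next
  note pcD = partial_cubeD[OF pc]
  assume "\<exists>i. f y = toggle i (f x)"
  then have "gdist V E x y = 1" using pcD(4) xy hdist_toggle_self by metis
  then obtain xs where xs: "walk V E xs" "hd xs = x" "last xs = y" "length xs = Suc 1"
    using gdist_walk[OF pcD(2) xy] by metis
  then obtain a b where "xs = [a, b]" by (auto simp: length_Suc_conv)
  then show "E x y" using xs by (auto simp: walk_def)
qed

lemma partial_cube_iso_family:
  assumes pc: "partial_cube_emb V E f"
  shows "iso_family (f ` V)"
  unfolding iso_family_def
proof (intro conjI ballI impI)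
  note pcD = partial_cubeD[OF pc]
  fix a assume "a \<in> f ` V"
  then show "finite a" using pcD(3) by blast
next
  note pcD = partial_cubeD[OF pc]
  fix a b assume "a \<in> f ` V" "b \<in> f ` V" "a \<noteq> b"
  then obtain x y where xy: "x \<in> V" "y \<in> V" "a = f x" "b = f y" "f x \<noteq> f y" by blast
  obtain xs where xs: "walk V E xs" "hd xs = x" "last xs = y" "length xs = Suc (gdist V E x y)"
    using gdist_walk[OF pcD(2) xy(1,2)] by metis
  have "gdist V E x y \<noteq> 0" using pcD(3,4) xy hdist_eq_0 by metis
  then have len: "Suc 0 < length xs" using xs(4) by simp
  define z where "z = xs ! Suc 0"
  have "z \<in> interval V E x y" unfolding interval_def z_def using xs len nth_mem by blast
  then have z: "z \<in> V" "btw (f x) (f y) (f z)" using interval_iff[OF pc xy(1,2)] by auto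
  have "xs ! 0 = x" using xs(1,2) by (simp add: walk_def hd_conv_nth)
  then have "E x z" using xs(1) len by (auto simp: walk_def z_def)
  then obtain i where i: "f z = toggle i (f x)" using edge_iff_toggle[OF pc xy(1) z(1)] by blast
  have "(i \<in> f x) \<noteq> (i \<in> f y)" using btwD[OF z(2), of i] i by auto
  then show "\<exists>i. (i \<in> a) \<noteq> (i \<in> b) \<and> toggle i a \<in> f ` V"
    using xy i z(1) by (intro exI[of _ i]) auto
qed

lemma convex_iff_family:
  assumes pc: "partial_cube_emb V E f" and A: "A \<subseteq> V"
  shows "convex V E A \<longleftrightarrow> convex_family (f ` V) (f ` A)"
proof
  assume c: "convex V E A"
  show "convex_family (f ` V) (f ` A)"
  proof (rule convex_familyI)
    show "f ` A \<subseteq> f ` V" using A by blast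
    fix p q r assume "p \<in> f ` A" "q \<in> f ` A" "r \<in> f ` V" "btw p q r"
    then obtain x y z where xyz: "x \<in> A" "y \<in> A" "z \<in> V" "r = f z" "btw (f x) (f y) (f z)"
      by blast
    then have "z \<in> interval V E x y" using interval_iff[OF pc, of x y z] A by blast
    then have "z \<in> A" using c xyz unfolding convex_def by blast
    then show "r \<in> f ` A" using xyz by blast
  qed
next
  assume c: "convex_family (f ` V) (f ` A)"
  show "convex V E A"
    unfolding convex_def
  proof (intro conjI ballI subsetI)
    show "x \<in> V" if "x \<in> A" for x using that A by blast
    fix x y z assume xy: "x \<in> A" "y \<in> A" and "z \<in> interval V E x y"
    then have z: "z \<in> V" "btw (f x) (f y) (f z)" using interval_iff[OF pc, of x y z] A by auto
    then have "f z \<in> f ` A" using convex_familyD[OF c, of "f x" "f y" "f z"] xy by blast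
    then show "z \<in> A" using partial_cube_inj[OF pc] A z(1) by (metis inj_on_image_mem_iff)
  qed
qed

text \<open>Geodesics between members of \<open>A\<close> lie in intervals, hence in
  \<open>A\<close>, so distances do not change and the same \<open>f\<close> works.\<close>

lemma partial_cube_induced:
  assumes pc: "partial_cube_emb V E f" and c: "convex V E A"
  shows "partial_cube_emb A (induced E A) f"
proof -
  note pcD = partial_cubeD[OF pc]
  have A: "A \<subseteq> V" using c by (simp add: convex_def)
  have geo: "\<exists>xs. walk A (induced E A) xs \<and> hd xs = x \<and> last xs = y \<and> length xs = Suc (gdist V E x y)"
    if xy: "x \<in> A" "y \<in> A" for x y
  proof -
    obtain xs where xs: "walk V E xs" "hd xs = x" "last xs = y" "length xs = Suc (gdist V E x y)"
      using gdist_walk[OF pcD(2)] xy A by (metis subsetD)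
    have "set xs \<subseteq> interval V E x y" unfolding interval_def using xs by blast
    then have "set xs \<subseteq> A" using c xy unfolding convex_def by blast
    then have "walk A (induced E A) xs" using xs(1) by (auto simp: walk_def induced_def)
    then show ?thesis using xs by blast
  qed
  have "gdist A (induced E A) x y = gdist V E x y" if xy: "x \<in> A" "y \<in> A" for x y
  proof (rule antisym)
    show "gdist A (induced E A) x y \<le> gdist V E x y" using geo[OF xy] gdist_le by metis
    have conn: "connected_graph A (induced E A)"
      unfolding connected_graph_def using geo by blast
    obtain xs where xs: "walk A (induced E A) xs" "hd xs = x" "last xs = y"
      "length xs = Suc (gdist A (induced E A) x y)"
      using gdist_walk[OF conn xy] by metis
    have "walk V E xs" using xs(1) A by (auto simp: walk_def induced_def)
    then show "gdist V E x y \<le> gdist A (induced E A) x y" using gdist_le xs by metis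
  qed
  moreover have "connected_graph A (induced E A)"
    unfolding connected_graph_def using geo by blast
  moreover have "graph A (induced E A)"
    using pcD(1) by (auto simp: graph_def induced_def)
  ultimately show ?thesis
    using pcD(3,4) A unfolding partial_cube_emb_def hdist_def by (auto simp: subset_iff)
qed

section \<open>Transfer of the pre-hull number\<close>

text \<open>The bound allows only the exponents \<open>0\<close> and \<open>1\<close>; the former is
  absorbed because \<open>Iset\<close> is extensive on sets of vertices.\<close>

lemma hull_subset_Iset:
  assumes pc: "partial_cube_emb V E f" and ph: "pre_hull_number V E \<le> 1" and C: "copoint V E x C"
  shows "convex_hull_g V E (insert x C) \<subseteq> Iset V E (insert x C)"
proof -
  obtain n where n: "n \<le> 1" "ph_prop V E n"
  proof (cases "\<exists>n. ph_prop V E n")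
    case True
    then have "ph_prop V E (LEAST n. ph_prop V E n)" by (rule LeastI_ex)
    moreover have "(LEAST n. ph_prop V E n) \<le> 1"
      using ph True by (simp add: pre_hull_number_def one_enat_def)
    ultimately show ?thesis using that by blast
  next
    case False
    then show ?thesis using ph by (auto simp: pre_hull_number_def)
  qed
  have sub: "insert x C \<subseteq> V" using C by (auto simp: copoint_def convex_def)
  have ext: "insert x C \<subseteq> Iset V E (insert x C)"
  proof
    fix z assume z: "z \<in> insert x C"
    then have "z \<in> interval V E z z"
      using interval_iff[OF pc, of z z z] sub by (auto simp: btw_def)
    then show "z \<in> Iset V E (insert x C)" using z unfolding Iset_def by blast
  qed
  have hull: "convex_hull_g V E (insert x C) = (Iset V E ^^ n) (insert x C)"
    using n(2) C unfolding ph_prop_def by blast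
  show ?thesis
  proof (cases n)
    case 0
    then show ?thesis using hull ext by (simp only: funpow_0)
  next
    case (Suc m)
    then have "n = Suc 0" using n(1) by simp
    then show ?thesis using hull by (simp only: funpow.simps comp_def id_apply)
  qed
qed

text \<open>Pulling \<open>W\<close> back along the injective \<open>f\<close> gives a copoint of
  the graph, to which \<open>hull_subset_Iset\<close> applies.\<close>

lemma hull_stable_image:
  assumes pc: "partial_cube_emb V E f" and ph: "pre_hull_number V E \<le> 1"
  shows "hull_stable (f ` V)"
proof (rule hull_stable_if_copoints[OF partial_cube_iso_family[OF pc]])
  note inj = partial_cube_inj[OF pc]
  fix p W q
  assume p: "p \<in> f ` V" and W: "convex_family (f ` V) W" "p \<notin> W"
    and mx: "\<And>D. convex_family (f ` V) D \<Longrightarrow> W \<subseteq> D \<Longrightarrow> p \<notin> D \<Longrightarrow> D = W"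
    and q: "q \<in> f ` V" and hl: "\<And>D. convex_family (f ` V) D \<Longrightarrow> insert p W \<subseteq> D \<Longrightarrow> q \<in> D"
  obtain x where x: "x \<in> V" "p = f x" using p by blast
  obtain v where v: "v \<in> V" "q = f v" using q by blast
  define C where "C = {c \<in> V. f c \<in> W}"
  have CV: "C \<subseteq> V" by (auto simp: C_def)
  have fC: "f ` C = W" using convex_family_subset[OF W(1)] by (auto simp: C_def)
  have "copoint V E x C"
    unfolding copoint_def
  proof (intro conjI allI impI)
    show "x \<in> V" by fact
    show "convex V E C" using convex_iff_family[OF pc CV] fC W(1) by simp
    show "x \<notin> C" using x W(2) by (simp add: C_def)
    fix D assume D: "convex V E D \<and> C \<subseteq> D \<and> x \<notin> D"
    have DV: "D \<subseteq> V" using D by (simp add: convex_def)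
    have "f ` D = W"
    proof (rule mx)
      show "convex_family (f ` V) (f ` D)" using convex_iff_family[OF pc DV] D by simp
      show "W \<subseteq> f ` D" using D fC by blast
      show "p \<notin> f ` D" using D x inj DV by (metis inj_on_image_mem_iff)
    qed
    then show "D = C" using fC inj_on_image_eq_iff[OF inj DV CV] by simp
  qed
  then have sub: "convex_hull_g V E (insert x C) \<subseteq> Iset V E (insert x C)"
    using hull_subset_Iset[OF pc ph] by blast
  have "v \<in> D" if D: "convex V E D" "insert x C \<subseteq> D" for D
  proof -
    have DV: "D \<subseteq> V" using D by (simp add: convex_def)
    have "q \<in> f ` D"
      by (rule hl) (use convex_iff_family[OF pc DV] D fC x in auto)
    then show ?thesis using v inj DV by (metis inj_on_image_mem_iff)
  qed
  then have "v \<in> Iset V E (insert x C)" using sub unfolding convex_hull_g_def by blast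
  then obtain a b where ab: "a \<in> insert x C" "b \<in> insert x C" "v \<in> interval V E a b"
    unfolding Iset_def by blast
  then have "btw (f a) (f b) q"
    using interval_iff[OF pc, of a b v] x(1) CV v(2) by blast
  moreover have "f a \<in> insert p W" "f b \<in> insert p W" using ab(1,2) x(2) fC by blast+
  ultimately show "\<exists>s\<in>insert p W. \<exists>t\<in>insert p W. btw s t q" by blast
qed

text \<open>A finite convex family is the image of a finite convex \<open>A\<close>, whose induced
  graph is a partial cube under the same \<open>f\<close>.\<close>

lemma peano_family_image:
  assumes pc: "partial_cube_emb V E f" and pe: "peano V E"
  shows "peano_family (f ` V)"
  unfolding peano_family_def
proof (intro conjI allI impI)
  show "iso_family (f ` V)" by (rule partial_cube_iso_family[OF pc])
  fix C assume C: "finite C" "convex_family (f ` V) C"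
  define A where "A = {a \<in> V. f a \<in> C}"
  have AV: "A \<subseteq> V" by (auto simp: A_def)
  have fA: "f ` A = C" using convex_family_subset[OF C(2)] by (auto simp: A_def)
  have "finite A"
    using C(1) fA partial_cube_inj[OF pc] AV by (metis finite_image_iff inj_on_subset)
  moreover have cA: "convex V E A" using convex_iff_family[OF pc AV] fA C(2) by simp
  ultimately have "pre_hull_number A (induced E A) \<le> 1" using pe by (simp add: peano_def)
  then show "hull_stable C"
    using hull_stable_image[OF partial_cube_induced[OF pc cA]] fA by simp
qed

lemma degree_eq_card_nb:
  assumes pc: "partial_cube_emb V E f" and x: "x \<in> V"
  shows "card {y \<in> V. E x y} = card (nb (f ` V) (f x))"
proof -
  have "f ` {y \<in> V. E x y} = (\<lambda>i. toggle i (f x)) ` nb (f ` V) (f x)"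
    using edge_iff_toggle[OF pc x] by (fastforce simp: nb_def)
  moreover have "card (f ` {y \<in> V. E x y}) = card {y \<in> V. E x y}"
    by (rule card_image, rule inj_on_subset[OF partial_cube_inj[OF pc]]) blast
  moreover have "card ((\<lambda>i. toggle i (f x)) ` nb (f ` V) (f x)) = card (nb (f ` V) (f x))"
    by (rule card_image) (simp add: inj_on_def)
  ultimately show ?thesis by simp
qed

theorem theorem4p33:
  fixes V :: "'a set" and E :: "'a \<Rightarrow> 'a \<Rightarrow> bool" and f :: "'a \<Rightarrow> 'i set"
    and A :: "'a set"
  assumes "partial_cube_emb V E f"
    and "peano V E"
    and "finite A" and "A \<noteq> {}"
    and "convex V E A"
    and "regular A (induced E A)"
  shows "gated V E A"
  unfolding gated_def
proof
  fix x assume x: "x \<in> V"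
  note pc = assms(1)
  have pG: "peano_family (f ` V)" by (rule peano_family_image[OF assms(1,2)])
  have AV: "A \<subseteq> V" using assms(5) by (simp add: convex_def)
  have cA: "convex_family (f ` V) (f ` A)" using convex_iff_family[OF pc AV] assms(5) by simp
  have pA: "partial_cube_emb A (induced E A) f" by (rule partial_cube_induced[OF pc assms(5)])
  obtain k where "\<And>a. a \<in> A \<Longrightarrow> card {b \<in> A. induced E A a b} = k"
    using assms(6) unfolding regular_def by blast
  then have "card (nb (f ` A) v) = k" if "v \<in> f ` A" for v
    using degree_eq_card_nb[OF pA] that by auto
  then have "antipodal (f ` A)"
    using regular_antipodal[OF _ peano_family_convex[OF pG cA]] assms(3) by blast
  then obtain g where "g \<in> f ` A" "\<And>z. z \<in> f ` A \<Longrightarrow> btw (f x) z g"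
    using antipodal_gated[OF pG _ cA, of "f x"] assms(3,4) x by blast
  then obtain y where "y \<in> A" "\<And>z. z \<in> A \<Longrightarrow> btw (f x) (f z) (f y)" by blast
  then show "\<exists>y\<in>A. \<forall>z\<in>A. y \<in> interval V E x z"
    using interval_iff[OF pc x] AV by blast
qed

end
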